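(* Let $A$ be a coherent quantale and consider the following properties: (1) $A$ is a $PP$-quantale; (2) $R(A)$ is a $PP$-frame; (3) the reticulation $L(A)$ is a Stone lattice. Then $(1)\Rightarrow(3)$ and $(2)\Leftrightarrow(3)$ hold. If $A$ is semiprime, then $(3)\Rightarrow(1)$ also holds.
   Context: A quantale is a complete lattice $(A,\vee,\wedge,0,1)$ with an associative multiplication distributing over arbitrary joins in each variable. All quantales are assumed commutative and integral ($1$ is the multiplicative unit). A frame is a quantale whose multiplication is $\wedge$. $K(A)$ is the set of compact elements. $A$ is algebraic if every element is a join of compact elements; $A$ is coherent if it is algebraic, $1\in K(A)$ and $K(A)$ is closed under multiplication. $a^{\perp}=\bigvee\{x\in A: ax=0\}$. $B(A)$ is the set of complemented elements of $A$ (those $e$ with $e\vee e^{\perp}=1$). An element $p<1$ is $m$-prime if $ab\le p$ implies $a\le p$ or $b\le p$; $\mathrm{Spec}(A)$ is the set of $m$-prime elements; $\rho(a)=\bigwedge\{p\in \mathrm{Spec}(A): a\le p\}$; $A$ is semiprime if $\rho(0)=0$. $R(A)=\{a\in A:\rho(a)=a\}$ is a frame, with meets as in $A$, joins $\rho(\bigvee_i a_i)$, bottom $\rho(0)$ and top $1$; for coherent $A$ it is a coherent frame. An algebraic quantale $Q$ with $1\in K(Q)$ is a $PP$-quantale if $c^{\perp}\in B(Q)$ for every $c\in K(Q)$; a $PP$-frame is a $PP$-quantale which is a frame (all notions computed in the frame itself). A bounded distributive lattice $L$ is a Stone lattice if for every $x\in L$ there is a complemented element $e$ of $L$ such that $\mathrm{Ann}(x)=\{y\in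 L: x\wedge y=0\}$ equals the principal ideal $\{y: y\le e\}$. The reticulation of a coherent quantale $A$ is the (unique up to isomorphism) bounded distributive lattice $L(A)$ together with a surjective map $\lambda_A:K(A)\to L(A)$ such that for all $a,b\in K(A)$: $\lambda_A(a\vee b)\le\lambda_A(a)\vee\lambda_A(b)$; $\lambda_A(ab)=\lambda_A(a)\wedge\lambda_A(b)$; $\lambda_A(a)\le\lambda_A(b)$ iff $a^n\le b$ for some integer $n\ge1$. *)

theory Defs
  imports Main
begin

class quantale = complete_lattice + comm_monoid_mult +
  assumes one_eq_top: "1 = top"
    and mult_Sup: "x * Sup Y = (SUP y\<in>Y. x * y)"

definition frame :: "'a::quantale itself \<Rightarrow> bool" where
  "frame _ \<longleftrightarrow> (\<forall>x y :: 'a. x * y = inf x y)"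

definition compact_elements :: "'a::quantale set" where
  "compact_elements = {c. \<forall>S. c \<le> Sup S \<longrightarrow> (\<exists>F. finite F \<and> F \<subseteq> S \<and> c \<le> Sup F)}"

definition algebraic :: "'a::quantale itself \<Rightarrow> bool" where
  "algebraic _ \<longleftrightarrow> (\<forall>a :: 'a. \<exists>C \<subseteq> compact_elements. a = Sup C)"

definition coherent :: "'a::quantale itself \<Rightarrow> bool" where
  "coherent T \<longleftrightarrow> algebraic T \<and> (1 :: 'a) \<in> compact_elements \<and>
     (\<forall>c \<in> compact_elements. \<forall>d \<in> compact_elements. c * d \<in> (compact_elements :: 'a set))"

definition perp :: "'a::quantale \<Rightarrow> 'a" where
  "perp a = Sup {x. a * x = bot}"

definition complemented_elements :: "'a::quantale set" where
  "complemented_elements = {e. sup e (perp e) = 1}"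

definition m_prime :: "'a::quantale \<Rightarrow> bool" where
  "m_prime p \<longleftrightarrow> p < 1 \<and> (\<forall>a b. a * b \<le> p \<longrightarrow> a \<le> p \<or> b \<le> p)"

definition Spec :: "'a::quantale set" where
  "Spec = {p. m_prime p}"

definition rho :: "'a::quantale \<Rightarrow> 'a" where
  "rho a = Inf {p \<in> Spec. a \<le> p}"

definition semiprime :: "'a::quantale itself \<Rightarrow> bool" where
  "semiprime _ \<longleftrightarrow> rho (bot :: 'a) = bot"

definition pp_quantale :: "'a::quantale itself \<Rightarrow> bool" where
  "pp_quantale T \<longleftrightarrow> algebraic T \<and> (1 :: 'a) \<in> compact_elements \<and>
     (\<forall>c \<in> (compact_elements :: 'a set). perp c \<in> complemented_elements)"

definition pp_frame :: "'a::quantale itself \<Rightarrow> bool" where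
  "pp_frame T \<longleftrightarrow> pp_quantale T \<and> frame T"


lemma rho_upper: "a \<le> rho a"
  unfolding rho_def by (auto intro: Inf_greatest)

lemma rho_mono: "a \<le> b \<Longrightarrow> rho a \<le> rho b"
  unfolding rho_def by (rule Inf_superset_mono) auto

lemma le_m_prime_iff: "p \<in> Spec \<Longrightarrow> rho a \<le> p \<longleftrightarrow> a \<le> p"
  unfolding rho_def using rho_upper[of a, unfolded rho_def]
  by (auto intro: Inf_lower order_trans)

lemma rho_cong: "(\<And>p. p \<in> Spec \<Longrightarrow> a \<le> p \<longleftrightarrow> b \<le> p) \<Longrightarrow> rho a = rho b"
  unfolding rho_def by (intro arg_cong[of _ _ Inf]) auto

lemma rho_idem [simp]: "rho (rho a) = rho a"
  by (rule rho_cong) (simp add: le_m_prime_iff)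

lemma rho_top [simp]: "rho top = top"
  using rho_upper[of top] by (simp add: top_unique)

lemma rho_le_iff: "rho b = b \<Longrightarrow> rho a \<le> b \<longleftrightarrow> a \<le> b"
  by (metis rho_mono rho_upper order_trans)

lemma rho_Inf_closed: "(\<And>x. x \<in> X \<Longrightarrow> rho x = x) \<Longrightarrow> rho (Inf X) = Inf X"
  by (intro antisym rho_upper Inf_greatest) (metis Inf_lower rho_mono)

lemma rho_inf_closed: "rho x = x \<Longrightarrow> rho y = y \<Longrightarrow> rho (inf x y) = inf x y"
  using rho_Inf_closed[of "{x, y}"] by auto

lemma mult_mono_right: "y \<le> z \<Longrightarrow> x * y \<le> x * (z :: 'a::quantale)"
  using mult_Sup[of x "{y, z}"] by (simp add: sup_absorb2 le_iff_sup)

lemma mult_le_left: "x * y \<le> (x :: 'a::quantale)"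
  using mult_mono_right[of y 1 x] by (metis mult.right_neutral one_eq_top top_greatest)

lemma mult_le_inf: "x * y \<le> inf x (y :: 'a::quantale)"
  using mult_le_left[of x y] mult_le_left[of y x] by (simp add: mult.commute)

lemma rho_mult_eq_rho_inf: "rho (x * y) = rho (inf x y)"
proof (rule rho_cong)
  fix p :: 'a assume "p \<in> Spec"
  then have "x * y \<le> p \<Longrightarrow> x \<le> p \<or> y \<le> p"
    by (auto simp: Spec_def m_prime_def)
  then show "x * y \<le> p \<longleftrightarrow> inf x y \<le> p"
    using mult_le_inf[of x y] by (meson inf_le1 inf_le2 order_trans)
qed

lemma inf_rho_Sup:
  assumes "rho x = x" and "\<And>y. y \<in> Y \<Longrightarrow> rho y = y"
  shows "inf x (rho (Sup Y)) = rho (SUP y\<in>Y. inf x y)"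
proof (rule antisym)
  have "inf x (rho (Sup Y)) = rho (inf x (rho (Sup Y)))"
    using assms(1) by (simp add: rho_inf_closed)
  also have "\<dots> = rho (x * rho (Sup Y))"
    by (simp add: rho_mult_eq_rho_inf)
  also have "\<dots> = rho (x * Sup Y)"
  proof (rule rho_cong)
    fix p :: 'a assume p: "p \<in> Spec"
    then have "x * z \<le> p \<longleftrightarrow> x \<le> p \<or> z \<le> p" for z
      using mult_le_inf[of x z]
      by (auto simp: Spec_def m_prime_def intro: order_trans)
    then show "x * rho (Sup Y) \<le> p \<longleftrightarrow> x * Sup Y \<le> p"
      using p by (simp add: le_m_prime_iff)
  qed
  also have "\<dots> \<le> rho (SUP y\<in>Y. inf x y)"
    unfolding mult_Sup by (intro rho_mono SUP_mono) (use mult_le_inf in blast)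
  finally show "inf x (rho (Sup Y)) \<le> rho (SUP y\<in>Y. inf x y)" .
  have "(SUP y\<in>Y. inf x y) \<le> inf x (rho (Sup Y))"
    by (intro SUP_least inf_mono order_refl) (meson Sup_upper rho_upper order_trans)
  then show "rho (SUP y\<in>Y. inf x y) \<le> inf x (rho (Sup Y))"
    by (subst rho_le_iff) (simp_all add: rho_inf_closed assms)
qed


text \<open>The frame \<open>R(A)\<close> of radical elements is a type of its own, so that compactness,
  \<open>perp\<close>, complements etc. on \<open>'a radical\<close> are those computed in \<open>R(A)\<close>, with joins
  \<open>rho (Sup X)\<close>, bottom \<open>rho bot\<close>, and the meet as multiplication.\<close>

typedef (overloaded) 'a radical = "{a :: 'a::quantale. rho a = a}"
  by (rule exI[of _ top]) simp

setup_lifting type_definition_radical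

instantiation radical :: (quantale) quantale
begin

lift_definition less_eq_radical :: "'a radical \<Rightarrow> 'a radical \<Rightarrow> bool" is "(\<le>)" .
lift_definition less_radical :: "'a radical \<Rightarrow> 'a radical \<Rightarrow> bool" is "(<)" .
lift_definition inf_radical :: "'a radical \<Rightarrow> 'a radical \<Rightarrow> 'a radical" is inf
  by (rule rho_inf_closed)
lift_definition sup_radical :: "'a radical \<Rightarrow> 'a radical \<Rightarrow> 'a radical" is "\<lambda>x y. rho (sup x y)"
  by simp
lift_definition Inf_radical :: "'a radical set \<Rightarrow> 'a radical" is Inf
  by (rule rho_Inf_closed)
lift_definition Sup_radical :: "'a radical set \<Rightarrow> 'a radical" is "\<lambda>X. rho (Sup X)"
  by simp
lift_definition bot_radical :: "'a radical" is "rho bot"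
  by simp
lift_definition top_radical :: "'a radical" is top
  by simp
lift_definition one_radical :: "'a radical" is top
  by simp
lift_definition times_radical :: "'a radical \<Rightarrow> 'a radical \<Rightarrow> 'a radical" is inf
  by (rule rho_inf_closed)

instance
proof
  fix x y z :: "'a radical" and X :: "'a radical set"
  show "x < y \<longleftrightarrow> x \<le> y \<and> \<not> y \<le> x" by transfer (rule less_le_not_le)
  show "x \<le> x" by transfer simp
  show "x \<le> y \<Longrightarrow> y \<le> z \<Longrightarrow> x \<le> z" by transfer (rule order_trans)
  show "x \<le> y \<Longrightarrow> y \<le> x \<Longrightarrow> x = y" by transfer (rule antisym)
  show "inf x y \<le> x" "inf x y \<le> y" by (transfer, simp)+
  show "x \<le> y \<Longrightarrow> x \<le> z \<Longrightarrow> x \<le> inf y z" by transfer simp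
  show "x \<le> sup x y" "y \<le> sup x y" by (transfer, meson rho_upper sup_ge1 sup_ge2 order_trans)+
  show "y \<le> x \<Longrightarrow> z \<le> x \<Longrightarrow> sup y z \<le> x" by transfer (simp add: rho_le_iff)
  show "x \<in> X \<Longrightarrow> Inf X \<le> x" by transfer (rule Inf_lower)
  show "(\<And>x. x \<in> X \<Longrightarrow> z \<le> x) \<Longrightarrow> z \<le> Inf X" by transfer (auto intro: Inf_greatest)
  show "x \<in> X \<Longrightarrow> x \<le> Sup X" by transfer (meson rho_upper Sup_upper order_trans)
  show "(\<And>x. x \<in> X \<Longrightarrow> x \<le> z) \<Longrightarrow> Sup X \<le> z"
    by transfer (auto simp: rho_le_iff intro: Sup_least)
  show "Inf {} = (top :: 'a radical)" by transfer simp
  show "Sup {} = (bot :: 'a radical)" by transfer simp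
  show "x * y * z = x * (y * z)" by transfer (rule inf_assoc)
  show "x * y = y * x" by transfer (rule inf_commute)
  show "1 * x = x" by transfer simp
  show "1 = (top :: 'a radical)" by transfer simp
  show "x * Sup X = (SUP y\<in>X. x * y)" by transfer (rule inf_rho_Sup, auto)
qed

end


definition complemented :: "'l::{distrib_lattice, bounded_lattice} \<Rightarrow> bool" where
  "complemented e \<longleftrightarrow> (\<exists>f. inf e f = bot \<and> sup e f = top)"

definition Ann :: "'l::{distrib_lattice, bounded_lattice} \<Rightarrow> 'l set" where
  "Ann x = {y. inf x y = bot}"

definition stone_lattice :: "'l::{distrib_lattice, bounded_lattice} itself \<Rightarrow> bool" where
  "stone_lattice _ \<longleftrightarrow> (\<forall>x :: 'l. \<exists>e. complemented e \<and> Ann x = {y. y \<le> e})"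

text \<open>\<open>lam\<close> exhibits the type \<open>'l\<close> as the reticulation of \<open>'a\<close>. Only its values on compact
  elements matter.\<close>

definition reticulation ::
    "('a::quantale \<Rightarrow> 'l::{distrib_lattice, bounded_lattice}) \<Rightarrow> bool" where
  "reticulation lam \<longleftrightarrow>
     lam ` compact_elements = UNIV \<and>
     (\<forall>a \<in> compact_elements. \<forall>b \<in> compact_elements.
        lam (sup a b) \<le> sup (lam a) (lam b) \<and>
        lam (a * b) = inf (lam a) (lam b) \<and>
        (lam a \<le> lam b \<longleftrightarrow> (\<exists>n \<ge> 1. a ^ n \<le> b)))"

end

theory Submission imports Defs begin

text \<open>By Krull's separation argument, a compact \<open>c\<close> lies below \<open>rho b\<close> iff some power of \<open>c\<close> lies
  below \<open>b\<close>. Hence the compact elements of \<open>R(A)\<close> are the elements \<open>rho c\<close> with \<open>c\<close> compact in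
  \<open>A\<close>, and \<open>R(A)\<close> is again a coherent quantale, with the same reticulation as \<open>A\<close> via
  \<open>rho c \<mapsto> lam c\<close>. As a frame, \<open>R(A)\<close> has no nonzero nilpotents, so the equivalence of (2)
  and (3) is the equivalence of (1) and (3) for reduced quantales, applied to \<open>R(A)\<close>. A
  PP-quantale has no nonzero compact nilpotents, so (1) implies (3) without semiprimeness.\<close>

section \<open>Quantale arithmetic\<close>

lemma mult_sup_distrib: "x * sup y z = sup (x * y) (x * (z :: 'a::quantale))"
  using mult_Sup[of x "{y, z}"] by simp

lemma mult_bot [simp]: "x * bot = (bot :: 'a::quantale)"
  using mult_Sup[of x "{}"] by simp

lemma mult_mono_both: "x \<le> x' \<Longrightarrow> y \<le> y' \<Longrightarrow> x * y \<le> x' * (y' :: 'a::quantale)"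
  by (metis mult_mono_right mult.commute order_trans)

lemma mult_perp [simp]: "a * perp a = (bot :: 'a::quantale)"
proof -
  have "a * perp a = (SUP x\<in>{x. a * x = bot}. a * x)"
    unfolding perp_def by (rule mult_Sup)
  also have "\<dots> = bot" by (simp add: bot_unique[symmetric] SUP_le_iff)
  finally show ?thesis .
qed

lemma le_perp_iff: "x \<le> perp a \<longleftrightarrow> a * x = (bot :: 'a::quantale)"
proof
  assume "x \<le> perp a"
  then have "a * x \<le> a * perp a" by (rule mult_mono_right)
  then show "a * x = bot" by (simp add: bot_unique)
next
  assume "a * x = bot" then show "x \<le> perp a"
    unfolding perp_def by (simp add: Sup_upper)
qed

lemma eq_bot_if_mult_bot_cover:
  assumes "sup e f = (1 :: 'a::quantale)" "x * e = bot" "x * f = bot"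
  shows "x = bot"
  using mult_sup_distrib[of x e f] assms by simp

text \<open>Multiplying the cover by \<open>x\<close> leaves \<open>x = x * e\<close>. This is how
  complements are exploited below: killing one half of a cover of \<open>1\<close> forces an element
  under the other half.\<close>

lemma le_if_mult_bot_cover:
  assumes "sup e f = (1 :: 'a::quantale)" "x * f = bot"
  shows "x \<le> e"
proof -
  have "x = sup (x * e) (x * f)" using mult_sup_distrib[of x e f] assms by simp
  then have "x = x * e" using assms by simp
  also have "\<dots> \<le> e" using mult_le_inf[of x e] by simp
  finally show ?thesis .
qed

section \<open>Compact elements\<close>

lemma compactD:
  "c \<in> compact_elements \<Longrightarrow> c \<le> Sup S \<Longrightarrow> \<exists>F. finite F \<and> F \<subseteq> S \<and> c \<le> Sup F"
  unfolding compact_elements_def by blast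

lemma compactI:
  "(\<And>S. c \<le> Sup S \<Longrightarrow> \<exists>F. finite F \<and> F \<subseteq> S \<and> c \<le> Sup F) \<Longrightarrow> c \<in> compact_elements"
  unfolding compact_elements_def by blast

lemma compact_bot: "bot \<in> compact_elements"
  by (rule compactI) (rule exI[of _ "{}"], simp)

lemma compact_sup:
  assumes "a \<in> compact_elements" "b \<in> compact_elements"
  shows "sup a b \<in> compact_elements"
proof (rule compactI)
  fix S assume "sup a b \<le> Sup S"
  then have "a \<le> Sup S" "b \<le> Sup S" by auto
  then obtain F G where F: "finite F" "F \<subseteq> S" "a \<le> Sup F" and G: "finite G" "G \<subseteq> S" "b \<le> Sup G"
    using compactD[OF assms(1)] compactD[OF assms(2)] by metis
  have "sup a b \<le> Sup (F \<union> G)"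
    using sup_mono[OF F(3) G(3)] by (simp add: Sup_union_distrib)
  then show "\<exists>F. finite F \<and> F \<subseteq> S \<and> sup a b \<le> Sup F"
    using F G by (intro exI[of _ "F \<union> G"]) auto
qed

lemma compact_Sup_finite: "finite F \<Longrightarrow> F \<subseteq> compact_elements \<Longrightarrow> Sup F \<in> compact_elements"
  by (induction F rule: finite_induct) (auto intro: compact_bot compact_sup)

text \<open>A finite subset of a chain is bounded by a member of the chain; nonemptiness of
  \<open>S\<close> supplies that bound for the empty subset.\<close>

lemma compact_le_Sup_chain:
  assumes "c \<in> compact_elements" "c \<le> Sup S" "S \<noteq> {}" "\<And>x y. x \<in> S \<Longrightarrow> y \<in> S \<Longrightarrow> x \<le> y \<or> y \<le> x"
  shows "\<exists>x\<in>S. c \<le> x"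
proof -
  obtain F where F: "finite F" "F \<subseteq> S" "c \<le> Sup F" using compactD assms(1,2) by blast
  have "\<exists>x\<in>S. Sup F \<le> x" using F(1,2)
  proof (induction F rule: finite_induct)
    case empty then show ?case using assms(3) by auto
  next
    case (insert y F)
    then obtain x where "x \<in> S" "Sup F \<le> x" by auto
    moreover have "y \<in> S" using insert by simp
    ultimately show ?case
      using assms(4)[of x y] by (metis Sup_insert order_trans sup_least order_refl)
  qed
  then show ?thesis using F(3) order_trans by blast
qed

text \<open>A cover of \<open>e\<close> together with \<open>f\<close> covers the compact element
  \<open>1\<close>. After passing to a finite subcover, \<open>f\<close> can be discarded again,
  since \<open>e * f = bot\<close>.\<close>

lemma compact_of_complement:
  assumes one: "(1 :: 'a::quantale) \<in> compact_elements"
    and e: "sup e f = (1 :: 'a)" and ef: "e * f = bot"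
  shows "e \<in> compact_elements"
proof (rule compactI)
  fix S assume S: "e \<le> Sup S"
  have "(1 :: 'a) \<le> Sup (insert f S)"
    using sup_mono[OF S order_refl[of f]] e by (simp add: sup_commute)
  then obtain F where F: "finite F" "F \<subseteq> insert f S" "1 \<le> Sup F" using compactD[OF one] by blast
  \<comment> \<open>Whether or not \<open>f\<close> occurs in \<open>F\<close>, it is split off, so
    that the remaining elements all come from \<open>S\<close>.\<close>
  have "Sup F \<le> Sup (insert f (F - {f}))" by (rule Sup_subset_mono) auto
  then have 1: "sup f (Sup (F - {f})) = 1"
    using F(3) one_eq_top by (metis Sup_insert order_trans top_unique)
  have "e \<le> Sup (F - {f})"
    by (rule le_if_mult_bot_cover[of _ f]) (use 1 ef in \<open>simp_all add: sup_commute\<close>)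
  then show "\<exists>F. finite F \<and> F \<subseteq> S \<and> e \<le> Sup F" using F by (intro exI[of _ "F - {f}"]) auto
qed

lemma compact_one: "coherent TYPE('a::quantale) \<Longrightarrow> (1 :: 'a) \<in> compact_elements"
  by (simp add: coherent_def)

lemma compact_mult:
  "coherent TYPE('a::quantale) \<Longrightarrow> c \<in> compact_elements \<Longrightarrow> d \<in> compact_elements \<Longrightarrow>
    c * d \<in> (compact_elements :: 'a set)"
  by (simp add: coherent_def)

lemma compact_power:
  assumes "coherent TYPE('a::quantale)" "(c :: 'a) \<in> compact_elements"
  shows "c ^ n \<in> compact_elements"
  by (induction n) (use assms in \<open>auto simp: coherent_def\<close>)

section \<open>Radicals and powers\<close>

lemma power_le_prime:
  assumes "p \<in> Spec" "c ^ n \<le> (p :: 'a::quantale)"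
  shows "c \<le> p"
  using assms(2)
proof (induction n)
  case 0
  then have "1 \<le> p" by simp
  moreover have "p < 1" using assms(1) by (simp add: Spec_def m_prime_def)
  ultimately show ?case by simp
next
  case (Suc n)
  then show ?case using assms(1) by (auto simp: Spec_def m_prime_def)
qed

lemma le_rho_if_power_le: "c ^ n \<le> b \<Longrightarrow> c \<le> rho b"
  unfolding rho_def by (rule Inf_greatest) (use power_le_prime order_trans in blast)

text \<open>Zorn's lemma yields a maximal element among those above \<open>b\<close> and above no
  positive power of \<open>c\<close>, and maximality makes it prime. Chains stay inside this set
  because powers of \<open>c\<close> are compact.\<close>

lemma exists_prime_avoiding_powers:
  assumes coh: "coherent TYPE('a::quantale)" and c: "(c :: 'a) \<in> compact_elements"
    and b: "\<And>n. n \<ge> 1 \<Longrightarrow> \<not> c ^ n \<le> b"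
  shows "\<exists>p\<in>Spec. b \<le> p \<and> \<not> c \<le> p"
proof -
  define P where "P = {x. b \<le> x \<and> (\<forall>n\<ge>1. \<not> c ^ n \<le> x)}"
  have "\<exists>u\<in>P. \<forall>x\<in>C. x \<le> u" if ch: "C \<in> Chains (relation_of (\<le>) P)" for C
  proof (cases "C = {}")
    case True
    \<comment> \<open>The empty chain is bounded by \<open>b\<close> itself.\<close>
    then show ?thesis using b by (auto simp: P_def)
  next
    case False
    have C: "C \<subseteq> P" using ch by (auto simp: Chains_def relation_of_def)
    have "x \<le> y \<or> y \<le> x" if "x \<in> C" "y \<in> C" for x y
      using ch that by (auto simp: Chains_def relation_of_def)
    then have "\<not> c ^ n \<le> Sup C" if "n \<ge> 1" for n
      using compact_le_Sup_chain[OF compact_power[OF coh c, of n] _ False] C that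
      unfolding P_def by blast
    moreover have "b \<le> Sup C" using False C unfolding P_def
      by (metis (mono_tags, lifting) Sup_upper2 ex_in_conv mem_Collect_eq subsetD)
    ultimately have "Sup C \<in> P" by (simp add: P_def)
    then show ?thesis using Sup_upper by blast
  qed
  then have "\<exists>p\<in>P. \<forall>x\<in>P. p \<le> x \<longrightarrow> x = p"
    by (intro predicate_Zorn partial_order_on_relation_ofI) auto
  then obtain p where p: "p \<in> P" and mx: "\<And>x. x \<in> P \<Longrightarrow> p \<le> x \<Longrightarrow> x = p" by blast
  have bp: "b \<le> p" and np: "\<And>n. n \<ge> 1 \<Longrightarrow> \<not> c ^ n \<le> p" using p by (auto simp: P_def)
  have cp: "\<not> c \<le> p" using np[of 1] by simp
  \<comment> \<open>By maximality, joining anything not below \<open>p\<close> to \<open>p\<close>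
    leaves the set \<open>P\<close>, which can only happen by capturing a power of
    \<open>c\<close>.\<close>
  have ex: "\<exists>n\<ge>1. c ^ n \<le> sup p x" if "\<not> x \<le> p" for x
  proof (rule ccontr)
    assume "\<not> (\<exists>n\<ge>1. c ^ n \<le> sup p x)"
    then have "sup p x \<in> P" using bp by (simp add: P_def le_supI1)
    then have "sup p x = p" by (rule mx) simp
    then show False using that by (simp add: sup.absorb_iff1)
  qed
  have "m_prime p" unfolding m_prime_def
  proof (intro conjI allI impI)
    show "p < 1" using cp by (metis one_eq_top top.not_eq_extremum top_greatest)
    fix x y assume xy: "x * y \<le> p"
    show "x \<le> p \<or> y \<le> p"
    proof (rule ccontr)
      assume "\<not> (x \<le> p \<or> y \<le> p)"
      then obtain m n where mn: "m \<ge> 1" "c ^ m \<le> sup p x" "n \<ge> 1" "c ^ n \<le> sup p y"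
        using ex by blast
      have "c ^ (m + n) \<le> sup p x * sup p y"
        unfolding power_add by (rule mult_mono_both) (use mn in auto)
      \<comment> \<open>In the expanded product every term other than \<open>x * y\<close> has a
        factor \<open>p\<close>.\<close>
      also have "\<dots> = sup (sup p x * p) (sup (p * y) (x * y))"
        by (metis mult_sup_distrib mult.commute)
      also have "\<dots> \<le> p"
        using xy mult_le_inf[of "sup p x" p] mult_le_left[of p y] by simp
      finally show False using np mn by simp
    qed
  qed
  then show ?thesis using bp cp by (auto simp: Spec_def)
qed

lemma compact_le_rho_iff:
  assumes "coherent TYPE('a::quantale)" "(c :: 'a) \<in> compact_elements"
  shows "c \<le> rho b \<longleftrightarrow> (\<exists>n\<ge>1. c ^ n \<le> b)"
  using exists_prime_avoiding_powers[OF assms, of b] le_rho_if_power_le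
  by (metis le_m_prime_iff order_trans)

section \<open>The reticulation\<close>

text \<open>This is the form of semiprimeness shared by semiprime quantales, frames and
  PP-quantales. The exponent \<open>0\<close> is harmless: \<open>1 = bot\<close> makes every
  element \<open>bot\<close>.\<close>

definition reduced :: "'a::quantale itself \<Rightarrow> bool" where
  "reduced _ \<longleftrightarrow> (\<forall>c \<in> (compact_elements :: 'a set). \<forall>n. c ^ n = bot \<longrightarrow> c = bot)"

lemma reducedD:
  "reduced TYPE('a::quantale) \<Longrightarrow> (c :: 'a) \<in> compact_elements \<Longrightarrow> c ^ n = bot \<Longrightarrow> c = bot"
  unfolding reduced_def by blast

lemma semiprime_reduced: "semiprime TYPE('a::quantale) \<Longrightarrow> reduced TYPE('a)"
  unfolding semiprime_def reduced_def by (metis bot_unique le_rho_if_power_le order_refl)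

lemma frame_reduced:
  assumes "frame TYPE('a::quantale)"
  shows "reduced TYPE('a)"
proof -
  have "c \<le> c ^ n" for c :: 'a and n
    using assms by (induction n) (auto simp: frame_def one_eq_top)
  then show ?thesis unfolding reduced_def by (metis bot_unique)
qed

text \<open>The exponent is lowered one step at a time: if \<open>c * c ^ n = bot\<close>, then both
  halves of the cover of \<open>1\<close> by \<open>perp c\<close> and \<open>perp (perp c)\<close>
  annihilate \<open>c ^ n\<close>, so \<open>c ^ n = bot\<close>.\<close>

lemma pp_quantale_reduced:
  assumes "pp_quantale TYPE('a::quantale)"
  shows "reduced TYPE('a)"
  unfolding reduced_def
proof (intro ballI allI impI)
  fix c :: 'a and n
  assume c: "c \<in> compact_elements" and "c ^ n = bot"
  have "sup (perp c) (perp (perp c)) = 1"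
    using assms c by (auto simp: pp_quantale_def complemented_elements_def)
  note cover = eq_bot_if_mult_bot_cover[OF this]
  show "c = bot" using \<open>c ^ n = bot\<close>
  proof (induction n)
    case 0
    then have "(1 :: 'a) = bot" by simp
    then show ?case by (metis mult_bot mult.right_neutral)
  next
    case (Suc n)
    show ?case
    proof (cases n)
      case 0
      then show ?thesis using Suc.prems by simp
    next
      \<comment> \<open>Positivity of \<open>n\<close> gives \<open>c ^ n\<close> a factor
        \<open>c\<close>, which \<open>perp c\<close> annihilates.\<close>
      case (Suc m)
      have "c ^ n \<le> perp c" using Suc.prems by (simp add: le_perp_iff)
      then have "c ^ n * perp (perp c) = bot"
        by (metis mult_mono_both order_refl mult_perp bot_unique)
      moreover have "c ^ n * perp c = bot"
        using Suc by (simp add: mult.assoc mult.left_commute[of c])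
      ultimately show ?thesis using cover Suc.IH by blast
    qed
  qed
qed

section \<open>The reticulation map, PP-quantales and Stone lattices\<close>

context
  fixes lam :: "'a::quantale \<Rightarrow> 'l::{distrib_lattice, bounded_lattice}"
  assumes coh: "coherent TYPE('a)" and ret: "reticulation lam"
begin

lemma lam_surj: "\<exists>c\<in>compact_elements. lam c = x"
  using ret unfolding reticulation_def by (metis UNIV_I imageE)

lemma lam_mult:
  "a \<in> compact_elements \<Longrightarrow> b \<in> compact_elements \<Longrightarrow> lam (a * b) = inf (lam a) (lam b)"
  using ret by (simp add: reticulation_def)

lemma lam_le_iff:
  "a \<in> compact_elements \<Longrightarrow> b \<in> compact_elements \<Longrightarrow> lam a \<le> lam b \<longleftrightarrow> (\<exists>n\<ge>1. a ^ n \<le> b)"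
  using ret by (simp add: reticulation_def)

lemma lam_mono:
  "a \<in> compact_elements \<Longrightarrow> b \<in> compact_elements \<Longrightarrow> a \<le> b \<Longrightarrow> lam a \<le> lam b"
  using lam_le_iff[of a b] by (metis le_refl power_one_right)

text \<open>One inequality is an axiom of the reticulation; the other is monotonicity.\<close>

lemma lam_sup:
  assumes "a \<in> compact_elements" "b \<in> compact_elements"
  shows "lam (sup a b) = sup (lam a) (lam b)"
  using assms ret compact_sup[OF assms]
  by (intro antisym sup_least lam_mono) (auto simp: reticulation_def)

lemma lam_bot: "lam bot = bot"
  using lam_surj[of bot] lam_mono[OF compact_bot] by (metis bot_least bot_unique)

lemma lam_one: "lam 1 = top"
  using lam_surj[of top] lam_mono[OF _ compact_one[OF coh]] by (metis one_eq_top top_greatest top_unique)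

lemma lam_eq_top_iff: "a \<in> compact_elements \<Longrightarrow> lam a = top \<longleftrightarrow> a = 1"
  using lam_le_iff[OF compact_one[OF coh], of a] lam_one
  by (metis one_eq_top power_one top_unique)

text \<open>\<open>lam a \<le> lam bot\<close> says that \<open>a\<close> is nilpotent. This is
  where reducedness enters both implications between PP-quantales and Stone lattices.\<close>

lemma lam_eq_bot_iff:
  "reduced TYPE('a) \<Longrightarrow> a \<in> compact_elements \<Longrightarrow> lam a = bot \<longleftrightarrow> a = bot"
  using lam_le_iff[OF _ compact_bot, of a] lam_bot
  by (metis bot_unique reducedD)

text \<open>For \<open>x = lam c\<close> the annihilator is generated by
  \<open>lam (perp c)\<close>. Being complemented, \<open>perp c\<close> is compact, so that
  \<open>lam\<close> is meaningful on it.\<close>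

lemma pp_quantale_imp_stone:
  assumes pp: "pp_quantale TYPE('a)"
  shows "stone_lattice TYPE('l)"
  unfolding stone_lattice_def
proof
  fix x :: 'l
  note red = pp_quantale_reduced[OF pp]
  obtain c where c: "c \<in> compact_elements" "lam c = x" using lam_surj by blast
  define e f where "e = perp c" and "f = perp e"
  have ef: "sup e f = 1" "e * f = bot"
    using pp c by (auto simp: pp_quantale_def complemented_elements_def e_def f_def)
  have e: "e \<in> compact_elements" using compact_of_complement[OF compact_one[OF coh] ef] .
  have f: "f \<in> compact_elements"
    using compact_of_complement[OF compact_one[OF coh], of f e] ef by (simp add: sup_commute mult.commute)
  have "complemented (lam e)"
    unfolding complemented_def
    using lam_mult[OF e f] lam_sup[OF e f] ef lam_bot lam_one by metis
  moreover have "inf x y = bot \<longleftrightarrow> y \<le> lam e" for y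
  proof -
    obtain d where d: "d \<in> compact_elements" "lam d = y" using lam_surj by blast
    have "inf x y = bot \<longleftrightarrow> c * d = bot"
      using lam_mult[OF c(1) d(1)] lam_eq_bot_iff[OF red compact_mult[OF coh c(1) d(1)]] c d by simp
    moreover have "c * d = bot \<Longrightarrow> y \<le> lam e"
      using lam_mono[OF d(1) e] d by (simp add: e_def le_perp_iff)
    moreover have "y \<le> lam e \<Longrightarrow> inf x y = bot"
    proof -
      assume "y \<le> lam e"
      then have "inf x y \<le> inf (lam c) (lam e)" using c by (simp add: le_infI2)
      also have "\<dots> = bot" using lam_mult[OF c(1) e] lam_bot by (simp add: e_def)
      finally show ?thesis by (simp add: bot_unique)
    qed
    ultimately show ?thesis by blast
  qed
  ultimately show "\<exists>e. complemented e \<and> Ann x = {y. y \<le> e}"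
    by (auto simp: Ann_def)
qed

text \<open>The generator of \<open>Ann (lam c)\<close> and its complement lift to compact elements
  \<open>e\<close> and \<open>f\<close>. As only \<open>bot\<close> maps to \<open>bot\<close> and
  only \<open>1\<close> to \<open>top\<close>, these are complements in the quantale, and
  \<open>e\<close> turns out to be \<open>perp c\<close>.\<close>

lemma stone_imp_pp_quantale:
  assumes red: "reduced TYPE('a)" and stone: "stone_lattice TYPE('l)"
  shows "pp_quantale TYPE('a)"
  unfolding pp_quantale_def
proof (intro conjI ballI)
  show alg: "algebraic TYPE('a)" "(1 :: 'a) \<in> compact_elements"
    using coh by (auto simp: coherent_def)
  fix c :: 'a assume c: "c \<in> compact_elements"
  obtain u v where ann: "Ann (lam c) = {y. y \<le> u}" and uv: "inf u v = bot" "sup u v = top"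
    using stone unfolding stone_lattice_def complemented_def by metis
  obtain e f where e: "e \<in> compact_elements" "lam e = u" and f: "f \<in> compact_elements" "lam f = v"
    using lam_surj by meson
  have ef: "e * f = bot"
    using lam_mult[OF e(1) f(1)] uv e f lam_eq_bot_iff[OF red compact_mult[OF coh]] by simp
  have cover: "sup e f = 1"
    using lam_sup[OF e(1) f(1)] uv e f lam_eq_top_iff[OF compact_sup] by simp
  have below: "c * d = bot \<longleftrightarrow> lam d \<le> lam e" if "d \<in> compact_elements" for d
  proof -
    have "c * d = bot \<longleftrightarrow> lam d \<in> Ann (lam c)"
      using lam_mult[OF c that] lam_eq_bot_iff[OF red compact_mult[OF coh c that]] by (simp add: Ann_def)
    then show ?thesis using ann e by simp
  qed
  have "perp c \<le> e"
  proof -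
    obtain C where C: "C \<subseteq> compact_elements" "perp c = Sup C"
      using alg unfolding algebraic_def by blast
    \<comment> \<open>\<open>lam d \<le> lam e\<close> alone would only put a power of
      \<open>d\<close> below \<open>e\<close>. The complement \<open>f\<close> gives
      \<open>d\<close> itself: \<open>lam (d * f)\<close> is \<open>bot\<close>, hence
      \<open>d * f = bot\<close>.\<close>
    have "d \<le> e" if "d \<in> C" for d
    proof (rule le_if_mult_bot_cover[OF cover])
      have d: "d \<in> compact_elements" using C that by blast
      have "d \<le> perp c" using C that by (simp add: Sup_upper)
      then have "lam d \<le> lam e" using below[OF d] by (simp add: le_perp_iff)
      then have "lam (d * f) \<le> inf (lam e) (lam f)" using lam_mult[OF d f(1)] by (simp add: le_infI1)
      then show "d * f = bot"
        using uv e f lam_eq_bot_iff[OF red compact_mult[OF coh d f(1)]] by (simp add: bot_unique)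
    qed
    then show ?thesis using C by (simp add: Sup_le_iff)
  qed
  moreover have "e \<le> perp c" using below[OF e(1)] by (simp add: le_perp_iff)
  ultimately have "perp c = e" by simp
  moreover have "sup e (perp e) = 1"
  proof -
    have "f \<le> perp e" using ef by (simp add: le_perp_iff)
    then show ?thesis using cover one_eq_top by (metis sup_mono order_refl top_unique)
  qed
  ultimately show "perp c \<in> complemented_elements" by (simp add: complemented_elements_def)
qed

end

section \<open>The frame of radical elements\<close>

text \<open>This is \<open>rho\<close> as a map onto the separate type of radical elements, left
  adjoint to the inclusion \<open>Rep_radical\<close>; the adjunction is what makes it preserve
  joins.\<close>

lift_definition radical_of :: "'a::quantale \<Rightarrow> 'a radical" is rho
  by simp

lemma radical_of_le_iff: "radical_of a \<le> r \<longleftrightarrow> a \<le> Rep_radical r"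
  by transfer (simp add: rho_le_iff)

lemma radical_of_mono: "a \<le> b \<Longrightarrow> radical_of a \<le> radical_of b"
  by transfer (rule rho_mono)

lemma radical_of_Sup: "radical_of (Sup S) = (SUP a\<in>S. radical_of a)"
  by (rule antisym)
    (auto simp: radical_of_le_iff Sup_le_iff SUP_le_iff
      intro!: radical_of_mono intro: Sup_upper SUP_upper radical_of_le_iff[THEN iffD1])

lemma radical_of_sup: "radical_of (sup a b) = sup (radical_of a) (radical_of b)"
  using radical_of_Sup[of "{a, b}"] by simp

lemma radical_of_Rep: "radical_of (Rep_radical r) = r"
  by transfer simp

text \<open>A prime above \<open>a * b\<close> is above \<open>a\<close> or \<open>b\<close>, hence
  above \<open>rho a\<close> or \<open>rho b\<close>.\<close>

lemma radical_of_mult: "radical_of (a * b) = radical_of a * radical_of b"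
proof transfer
  fix a b :: 'a
  show "rho (a * b) = inf (rho a) (rho b)"
  proof (rule antisym)
    show "rho (a * b) \<le> inf (rho a) (rho b)"
      using mult_le_inf[of a b] by (auto intro: rho_mono)
    have "inf (rho a) (rho b) \<le> p" if p: "p \<in> Spec" "a * b \<le> p" for p
    proof -
      have "a \<le> p \<or> b \<le> p" using p by (auto simp: Spec_def m_prime_def)
      then have "rho a \<le> p \<or> rho b \<le> p" using le_m_prime_iff[OF p(1)] by blast
      then show ?thesis by (auto intro: le_infI1 le_infI2)
    qed
    then show "inf (rho a) (rho b) \<le> rho (a * b)"
      unfolding rho_def[of "a * b"] by (auto intro: Inf_greatest)
  qed
qed

lemma radical_of_one: "radical_of 1 = 1"
  unfolding one_eq_top by transfer simp

lemma frame_radical: "frame TYPE('a::quantale radical)"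
  unfolding frame_def by (intro allI, transfer) simp

section \<open>Compact elements, coherence and reticulation of the frame of radicals\<close>

context
  assumes coh: "coherent TYPE('a::quantale)"
begin

lemma radical_of_le_radical_of_iff:
  assumes "a \<in> compact_elements"
  shows "radical_of a \<le> radical_of b \<longleftrightarrow> (\<exists>n\<ge>1. a ^ n \<le> (b :: 'a))"
  using compact_le_rho_iff[OF coh assms] by (simp add: radical_of_le_iff radical_of.rep_eq)

text \<open>A cover in \<open>R(A)\<close> puts some power \<open>c ^ n\<close> below the join taken
  in \<open>A\<close>. Compactness of \<open>c ^ n\<close> selects finitely many members, and
  passing back to radicals removes the exponent.\<close>

lemma radical_of_compact:
  assumes c: "(c :: 'a) \<in> compact_elements"
  shows "radical_of c \<in> compact_elements"
proof (rule compactI)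
  fix S :: "'a radical set" assume S: "radical_of c \<le> Sup S"
  have Sup_eq: "radical_of (SUP r\<in>T. Rep_radical r) = Sup T" for T :: "'a radical set"
    by (simp add: radical_of_Sup image_image radical_of_Rep)
  obtain n where n: "n \<ge> 1" "c ^ n \<le> (SUP r\<in>S. Rep_radical r)"
    using S radical_of_le_radical_of_iff[OF c] by (metis Sup_eq)
  obtain F where F: "finite F" "F \<subseteq> S" "c ^ n \<le> (SUP r\<in>F. Rep_radical r)"
    using compactD[OF compact_power[OF coh c] n(2)] by (metis finite_subset_image)
  have "radical_of c \<le> Sup F"
    using radical_of_le_radical_of_iff[OF c] n(1) F(3) by (metis Sup_eq)
  then show "\<exists>F. finite F \<and> F \<subseteq> S \<and> radical_of c \<le> Sup F" using F by blast
qed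

lemma radical_eq_Sup: "\<exists>C\<subseteq>compact_elements. (r :: 'a radical) = (SUP c\<in>C. radical_of c)"
  using coh radical_of_Sup radical_of_Rep unfolding coherent_def algebraic_def by metis

text \<open>A compact radical is a join of images of compact elements, so finitely many suffice;
  their join in \<open>A\<close> is the required preimage.\<close>

lemma compact_radical_iff:
  "(r :: 'a radical) \<in> compact_elements \<longleftrightarrow> (\<exists>c\<in>compact_elements. r = radical_of c)"
proof
  assume r: "r \<in> compact_elements"
  obtain C where C: "C \<subseteq> compact_elements" "r = (SUP c\<in>C. radical_of c)"
    using radical_eq_Sup by blast
  obtain F where F: "finite F" "F \<subseteq> C" "r \<le> (SUP c\<in>F. radical_of c)"
    using compactD[OF r, of "radical_of ` C"] C(2) by (metis finite_subset_image order_refl)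
  have "(SUP c\<in>F. radical_of c) \<le> r" unfolding C(2) by (rule SUP_subset_mono) (use F in auto)
  then have "r = radical_of (Sup F)" using F by (simp add: radical_of_Sup)
  moreover have "Sup F \<in> compact_elements" using compact_Sup_finite F C by blast
  ultimately show "\<exists>c\<in>compact_elements. r = radical_of c" by blast
qed (auto intro: radical_of_compact)

lemma coherent_radical: "coherent TYPE('a radical)"
  unfolding coherent_def
proof (intro conjI ballI)
  show "algebraic TYPE('a radical)" unfolding algebraic_def
  proof
    fix r :: "'a radical"
    obtain C where "C \<subseteq> compact_elements" "r = (SUP c\<in>C. radical_of c)"
      using radical_eq_Sup by blast
    then show "\<exists>C\<subseteq>compact_elements. r = Sup C"
      using radical_of_compact by (intro exI[of _ "radical_of ` C"]) blast
  qed
  show "(1 :: 'a radical) \<in> compact_elements"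
    using radical_of_compact[of 1] coh by (simp add: radical_of_one coherent_def)
  show "r * s \<in> compact_elements" if "r \<in> compact_elements" "s \<in> compact_elements"
    for r s :: "'a radical"
    using that coh unfolding compact_radical_iff coherent_def by (metis radical_of_mult)
qed

lemma reticulation_radical:
  fixes lam :: "'a \<Rightarrow> 'l::{distrib_lattice, bounded_lattice}"
  assumes ret: "reticulation lam"
  shows "\<exists>lam' :: 'a radical \<Rightarrow> 'l. reticulation lam'"
proof -
  have lam_le: "lam a \<le> lam b \<longleftrightarrow> radical_of a \<le> radical_of b"
    if "a \<in> compact_elements" "b \<in> compact_elements" for a b
    using lam_le_iff[OF coh ret that] radical_of_le_radical_of_iff[OF that(1)] by simp
  \<comment> \<open>Any compact representative will do: by \<open>lam_le\<close>, the value of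
    \<open>lam\<close> depends only on the radical.\<close>
  define lam' where "lam' r = lam (SOME c. c \<in> compact_elements \<and> r = radical_of c)" for r
  have lam': "lam' (radical_of c) = lam c" if c: "c \<in> compact_elements" for c
  proof -
    define d where "d = (SOME d. d \<in> compact_elements \<and> radical_of c = radical_of d)"
    have "d \<in> compact_elements \<and> radical_of c = radical_of d"
      unfolding d_def by (rule someI[of _ c]) (use c in simp)
    then have "lam d = lam c" using lam_le[of c d] lam_le[of d c] c by (simp add: antisym)
    then show ?thesis by (simp add: lam'_def d_def)
  qed
  \<comment> \<open>Multiplication in \<open>R(A)\<close> is the meet, so the power condition of a
    reticulation collapses to the order; \<open>n = 0\<close> must be excluded because
    \<open>r ^ 0 = 1\<close>.\<close>
  have pow: "r ^ n = r" if "n \<ge> 1" for r :: "'a radical" and n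
    using that
  proof (induction n rule: dec_induct)
    case (step n)
    then show ?case using frame_radical[where ?'a = 'a] by (simp add: frame_def)
  qed simp
  have "reticulation lam'" unfolding reticulation_def
  proof (intro conjI ballI)
    show "lam' ` compact_elements = UNIV"
      using lam_surj[OF coh ret] lam' radical_of_compact by (metis UNIV_eq_I imageI)
  next
    fix r s :: "'a radical" assume "r \<in> compact_elements" "s \<in> compact_elements"
    then obtain a b where ab: "a \<in> compact_elements" "b \<in> compact_elements"
      and r: "r = radical_of a" and s: "s = radical_of b"
      unfolding compact_radical_iff by blast
    show "lam' (sup r s) \<le> sup (lam' r) (lam' s)"
      using lam_sup[OF coh ret ab] lam' ab compact_sup[OF ab]
      by (simp add: r s radical_of_sup[symmetric])
    show "lam' (r * s) = inf (lam' r) (lam' s)"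
      using lam_mult[OF coh ret ab] lam' ab compact_mult[OF coh ab]
      by (simp add: r s radical_of_mult[symmetric])
    show "lam' r \<le> lam' s \<longleftrightarrow> (\<exists>n\<ge>1. r ^ n \<le> s)"
      using lam_le[OF ab] lam' ab pow by (auto simp: r s)
  qed
  then show ?thesis by blast
qed

end

theorem theorem8p3:
  fixes lam :: "'a::quantale \<Rightarrow> 'l::{distrib_lattice, bounded_lattice}"
  assumes "coherent TYPE('a)"
    and "reticulation lam"
  shows "(pp_quantale TYPE('a) \<longrightarrow> stone_lattice TYPE('l)) \<and>
    (pp_frame TYPE('a radical) \<longleftrightarrow> stone_lattice TYPE('l)) \<and>
    (semiprime TYPE('a) \<longrightarrow> stone_lattice TYPE('l) \<longrightarrow> pp_quantale TYPE('a))"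
proof -
  obtain lam' :: "'a radical \<Rightarrow> 'l" where ret': "reticulation lam'"
    using reticulation_radical[OF assms] by blast
  note coh' = coherent_radical[OF assms(1)]
  have "pp_frame TYPE('a radical) \<longleftrightarrow> stone_lattice TYPE('l)"
    using pp_quantale_imp_stone[OF coh' ret'] stone_imp_pp_quantale[OF coh' ret']
      frame_reduced[OF frame_radical] frame_radical
    unfolding pp_frame_def by blast
  then show ?thesis
    using pp_quantale_imp_stone[OF assms] stone_imp_pp_quantale[OF assms] semiprime_reduced
    by blast
qed

end
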